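(* Let $\mathbf w\in\Gamma^n$, and let $\eta_1,\ldots,\eta_l$ be elements of $\Omega_{k[\mathbf x]/k}$ for $l\ge2$. Then there exist $1\le i_1<i_2\le l$ such that $$\deg_{\mathbf w}\eta_{i_1}+\deg_{\mathbf w}\tilde\eta_{i_1}=\deg_{\mathbf w}\eta_{i_2}+\deg_{\mathbf w}\tilde\eta_{i_2}\ \ge\ \deg_{\mathbf w}\eta_i+\deg_{\mathbf w}\tilde\eta_i$$ for $i=1,\ldots,l$, where $\tilde\eta_i=\eta_1\wedge\cdots\wedge\eta_{i-1}\wedge\eta_{i+1}\wedge\cdots\wedge\eta_l$ for each $i$.
   Context: $k$ is a field of characteristic zero, $k[\mathbf x]=k[x_1,\ldots,x_n]$ is the polynomial ring in $n\ge1$ variables, and $\Gamma$ is a totally ordered additive group (abelian, with order compatible with addition). For $\mathbf w=(w_1,\ldots,w_n)\in\Gamma^n$, the $\mathbf w$-weighted grading $k[\mathbf x]=\bigoplus_{\gamma\in\Gamma}k[\mathbf x]_\gamma$ is given by letting $k[\mathbf x]_\gamma$ be the $k$-span of the monomials $x_1^{a_1}\cdots x_n^{a_n}$ with $\sum_i a_iw_i=\gamma$. For $f=\sum_\gamma f_\gamma\neq0$ with $f_\gamma\in k[\mathbf x]_\gamma$, $\deg_{\mathbf w}f$ is the maximum of the $\gamma$ with $f_\gamma\ne0$; $\deg_{\mathbf w}0=-\infty$, a symbol less than every element of $\Gamma$, with $(-\infty)+\gamma=\gamma+(-\infty)=-\infty$ for $\gamma\in\Gamma\cup\{-\infty\}$.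 $\Omega_{k[\mathbf x]/k}$ is the module of differentials of $k[\mathbf x]$ over $k$, free with basis $dx_1,\ldots,dx_n$. For $\eta\in\bigwedge^s\Omega_{k[\mathbf x]/k}$, written uniquely as $\eta=\sum_{1\le i_1<\cdots<i_s\le n}h_{i_1,\ldots,i_s}dx_{i_1}\wedge\cdots\wedge dx_{i_s}$ with coefficients in $k[\mathbf x]$, put $\deg_{\mathbf w}\eta=\max\{\deg_{\mathbf w}(h_{i_1,\ldots,i_s})+w_{i_1}+\cdots+w_{i_s}\}$, the maximum over $1\le i_1<\cdots<i_s\le n$; the zero form has degree $-\infty$. *)

theory Defs
  imports Complex_Main "HOL-Library.Poly_Mapping" "HOL-Library.Extended"
begin

text \<open>
  The variables are indexed by a nonempty finite linearly ordered type \<open>'n\<close>, whose cardinality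
  is \<open>n\<close>.  A monomial is its exponent vector of type \<open>'n \<Rightarrow>\<^sub>0 nat\<close>; the ring structure on
  polynomials is the convolution product of \<open>Poly_Mapping\<close>.
\<close>

type_synonym ('n, 'k) mpoly = "('n \<Rightarrow>\<^sub>0 nat) \<Rightarrow>\<^sub>0 'k"

text \<open>The inner sum is the multiple \<open>a\<^sub>i w\<^sub>i\<close> in the ordered group.\<close>

definition mweight :: "('n::finite \<Rightarrow> 'g::linordered_ab_group_add) \<Rightarrow> ('n \<Rightarrow>\<^sub>0 nat) \<Rightarrow> 'g" where
  "mweight w a = (\<Sum>i\<in>UNIV. \<Sum>_<Poly_Mapping.lookup a i. w i)"

definition graded_piece ::
  "('n::finite \<Rightarrow> 'g::linordered_ab_group_add) \<Rightarrow> 'g \<Rightarrow> ('n, 'k::field_char_0) mpoly set" where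
  "graded_piece w \<gamma> = {f. \<forall>a\<in>Poly_Mapping.keys f. mweight w a = \<gamma>}"

definition wcomp ::
  "('n::finite \<Rightarrow> 'g::linordered_ab_group_add) \<Rightarrow> 'g \<Rightarrow> ('n, 'k::field_char_0) mpoly \<Rightarrow> ('n, 'k) mpoly" where
  "wcomp w \<gamma> f =
     (\<Sum>a\<in>{a\<in>Poly_Mapping.keys f. mweight w a = \<gamma>}.
        Poly_Mapping.single a (Poly_Mapping.lookup f a))"

text \<open>
  Degrees live in the type \<open>'g extended\<close>, where \<open>Minf\<close> plays the role of the symbol
  \<open>-\<infinity>\<close>.  The other extra element \<open>Pinf\<close> is never the degree of anything.
\<close>

definition wdeg ::
  "('n::finite \<Rightarrow> 'g::linordered_ab_group_add) \<Rightarrow> ('n, 'k::field_char_0) mpoly \<Rightarrow> 'g extended" where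
  "wdeg w f = (if f = 0 then Minf else Fin (Max {\<gamma>. wcomp w \<gamma> f \<noteq> 0}))"

lemma lookup_wcomp:
  "Poly_Mapping.lookup (wcomp w \<gamma> f) a =
     (if mweight w a = \<gamma> then Poly_Mapping.lookup f a else 0)"
proof -
  have "Poly_Mapping.lookup (wcomp w \<gamma> f) a =
      (\<Sum>b\<in>{b\<in>Poly_Mapping.keys f. mweight w b = \<gamma>}. if b = a then Poly_Mapping.lookup f b else 0)"
    unfolding wcomp_def lookup_sum by (rule sum.cong) (auto simp: lookup_single when_def)
  also have "\<dots> = (if mweight w a = \<gamma> then Poly_Mapping.lookup f a else 0)"
    by (auto simp: sum.delta in_keys_iff)
  finally show ?thesis .
qed

lemma wcomp_in_graded_piece: "wcomp w \<gamma> f \<in> graded_piece w \<gamma>"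
  by (auto simp: graded_piece_def in_keys_iff lookup_wcomp split: if_splits)

lemma wcomp_nonzero: "{\<gamma>. wcomp w \<gamma> f \<noteq> 0} = mweight w ` Poly_Mapping.keys f"
proof -
  have "wcomp w \<gamma> f \<noteq> 0 \<longleftrightarrow> (\<exists>a\<in>Poly_Mapping.keys f. mweight w a = \<gamma>)" for \<gamma>
    by (auto simp: poly_mapping_eq_iff fun_eq_iff lookup_wcomp in_keys_iff)
  then show ?thesis by auto
qed

lemma finite_wcomp_nonzero: "finite {\<gamma>. wcomp w \<gamma> f \<noteq> 0}"
  by (simp add: wcomp_nonzero)

lemma sum_wcomp: "(\<Sum>\<gamma>\<in>{\<gamma>. wcomp w \<gamma> f \<noteq> 0}. wcomp w \<gamma> f) = f"
proof (rule poly_mapping_eqI)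
  fix a
  have "Poly_Mapping.lookup (\<Sum>\<gamma>\<in>{\<gamma>. wcomp w \<gamma> f \<noteq> 0}. wcomp w \<gamma> f) a =
      (\<Sum>\<gamma>\<in>mweight w ` Poly_Mapping.keys f. if mweight w a = \<gamma> then Poly_Mapping.lookup f a else 0)"
    by (simp only: lookup_sum lookup_wcomp wcomp_nonzero)
  also have "\<dots> = Poly_Mapping.lookup f a"
    by (subst sum.delta') (auto simp: in_keys_iff)
  finally show "Poly_Mapping.lookup (\<Sum>\<gamma>\<in>{\<gamma>. wcomp w \<gamma> f \<noteq> 0}. wcomp w \<gamma> f) a
      = Poly_Mapping.lookup f a" .
qed


text \<open>
  An element of the exterior algebra is given by its coordinates in the basis
  \<open>dx\<^sub>I = dx\<^bsub>i\<^sub>1\<^esub> \<and> \<dots> \<and> dx\<^bsub>i\<^sub>s\<^esub>\<close>, where \<open>I = {i\<^sub>1 < \<dots> < i\<^sub>s}\<close> ranges over the subsets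
  of the index type; \<open>Poly_Mapping.single I h\<close> is \<open>h dx\<^sub>I\<close>.
\<close>

type_synonym ('n, 'k) diff_form = "'n set \<Rightarrow>\<^sub>0 ('n, 'k) mpoly"

definition forms :: "nat \<Rightarrow> ('n::finite, 'k::field_char_0) diff_form set" where
  "forms s = {\<eta>. \<forall>I\<in>Poly_Mapping.keys \<eta>. card I = s}"

definition dx :: "'n \<Rightarrow> ('n::finite, 'k::field_char_0) diff_form" where
  "dx i = Poly_Mapping.single {i} 1"

text \<open>The sign of the permutation that sorts the concatenation of \<open>I\<close> and \<open>J\<close>.\<close>

definition wedge_sign :: "'n::{finite,linorder} set \<Rightarrow> 'n set \<Rightarrow> 'r::comm_ring_1" where
  "wedge_sign I J = (- 1) ^ card {(i, j). i \<in> I \<and> j \<in> J \<and> j < i}"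

text \<open>
  The bilinear extension of \<open>dx\<^sub>I \<and> dx\<^sub>J = \<plusminus> dx\<^bsub>I \<union> J\<^esub>\<close> for disjoint \<open>I\<close>, \<open>J\<close> and
  \<open>dx\<^sub>I \<and> dx\<^sub>J = 0\<close> otherwise.
\<close>

definition wedge ::
  "('n::{finite,linorder}, 'k::field_char_0) diff_form \<Rightarrow> ('n, 'k) diff_form \<Rightarrow> ('n, 'k) diff_form"
where
  "wedge \<eta> \<theta> = (\<Sum>I\<in>UNIV. \<Sum>J\<in>UNIV.
     if I \<inter> J = {} then
       Poly_Mapping.single (I \<union> J)
         (wedge_sign I J * Poly_Mapping.lookup \<eta> I * Poly_Mapping.lookup \<theta> J)
     else 0)"

definition wedge_list ::
  "('n::{finite,linorder}, 'k::field_char_0) diff_form list \<Rightarrow> ('n, 'k) diff_form" where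
  "wedge_list \<eta>s = foldr wedge \<eta>s (Poly_Mapping.single {} 1)"

text \<open>
  The maximum may be taken over all subsets, since coefficients equal to \<open>0\<close> contribute \<open>Minf\<close>;
  see \<open>form_deg_eq_Max_card\<close> below.
\<close>

definition form_deg ::
  "('n::{finite,linorder} \<Rightarrow> 'g::linordered_ab_group_add) \<Rightarrow> ('n, 'k::field_char_0) diff_form
    \<Rightarrow> 'g extended" where
  "form_deg w \<eta> =
     Max ((\<lambda>I. wdeg w (Poly_Mapping.lookup \<eta> I) + Fin (\<Sum>i\<in>I. w i)) ` UNIV)"

lemma form_deg_zero: "form_deg w 0 = Minf"
  by (simp add: form_deg_def wdeg_def image_constant_conv)

lemma form_deg_eq_Max_card:
  fixes \<eta> :: "('n::{finite,linorder}, 'k::field_char_0) diff_form"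
  assumes "\<eta> \<in> forms s" "s \<le> card (UNIV :: 'n set)"
  shows "form_deg w \<eta> =
    Max ((\<lambda>I. wdeg w (Poly_Mapping.lookup \<eta> I) + Fin (\<Sum>i\<in>I. w i)) ` {I. card I = s})"
    (is "_ = Max (?d ` _)")
proof -
  obtain I0 :: "'n set" where I0: "card I0 = s"
    using assms(2) obtain_subset_with_card_n by blast
  have other: "?d I = Minf" if "card I \<noteq> s" for I
    using that assms(1) by (auto simp: forms_def in_keys_iff wdeg_def)
  show ?thesis unfolding form_deg_def
  proof (rule antisym)
    show "Max (?d ` UNIV) \<le> Max (?d ` {I. card I = s})"
    proof (rule Max.boundedI)
      fix y assume "y \<in> ?d ` UNIV"
      then obtain I where y: "y = ?d I" by blast
      show "y \<le> Max (?d ` {I. card I = s})"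
      proof (cases "card I = s")
        case True
        then show ?thesis unfolding y by (intro Max_ge) auto
      next
        case False
        then show ?thesis unfolding y other[OF False] by simp
      qed
    qed auto
    show "Max (?d ` {I. card I = s}) \<le> Max (?d ` UNIV)"
      by (rule Max_mono) (use I0 in auto)
  qed
qed

lemma diff_form_expansion:
  "\<eta> = (\<Sum>I\<in>UNIV. Poly_Mapping.single I (Poly_Mapping.lookup \<eta> I))"
  for \<eta> :: "('n::finite, 'k::field_char_0) diff_form"
  by (rule poly_mapping_eqI) (simp add: lookup_sum lookup_single when_def)

lemma wedge_single:
  "wedge (Poly_Mapping.single I f) (Poly_Mapping.single J g) =
     (if I \<inter> J = {} then Poly_Mapping.single (I \<union> J) (wedge_sign I J * f * g) else 0)"
proof -
  have "wedge (Poly_Mapping.single I f) (Poly_Mapping.single J g) =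
     (\<Sum>I'\<in>UNIV. \<Sum>J'\<in>UNIV. if J' = J then if I' = I then
       (if I \<inter> J = {} then Poly_Mapping.single (I \<union> J) (wedge_sign I J * f * g) else 0) else 0 else 0)"
    unfolding wedge_def by (intro sum.cong refl) (auto simp: lookup_single when_def)
  then show ?thesis by simp
qed

lemma wedge_add_left: "wedge (\<eta> + \<eta>') \<theta> = wedge \<eta> \<theta> + wedge \<eta>' \<theta>"
  unfolding wedge_def sum.distrib[symmetric]
  by (intro sum.cong refl) (auto simp: lookup_add algebra_simps simp flip: single_add)

lemma wedge_add_right: "wedge \<eta> (\<theta> + \<theta>') = wedge \<eta> \<theta> + wedge \<eta> \<theta>'"
  unfolding wedge_def sum.distrib[symmetric]
  by (intro sum.cong refl) (auto simp: lookup_add algebra_simps simp flip: single_add)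

lemma wedge_zero_left [simp]: "wedge 0 \<theta> = 0"
  by (auto simp: wedge_def intro!: sum.neutral)

lemma wedge_zero_right [simp]: "wedge \<eta> 0 = 0"
  by (auto simp: wedge_def intro!: sum.neutral)

lemma wedge_sum_left: "wedge (\<Sum>a\<in>A. f a) \<theta> = (\<Sum>a\<in>A. wedge (f a) \<theta>)"
  by (induction A rule: infinite_finite_induct) (auto simp: wedge_add_left)

lemma wedge_sum_right: "wedge \<eta> (\<Sum>a\<in>A. f a) = (\<Sum>a\<in>A. wedge \<eta> (f a))"
  by (induction A rule: infinite_finite_induct) (auto simp: wedge_add_right)

lemma wedge_sign_Un_left:
  fixes I J K :: "'n::{finite,linorder} set"
  assumes "I \<inter> J = {}"
  shows "wedge_sign (I \<union> J) K = wedge_sign I K * (wedge_sign J K :: 'r::comm_ring_1)"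
proof -
  have "{(i, j). i \<in> I \<union> J \<and> j \<in> K \<and> j < i} =
     {(i, j). i \<in> I \<and> j \<in> K \<and> j < i} \<union> {(i, j). i \<in> J \<and> j \<in> K \<and> j < i}" by auto
  moreover have "card \<dots> =
     card {(i, j). i \<in> I \<and> j \<in> K \<and> j < i} + card {(i, j). i \<in> J \<and> j \<in> K \<and> j < i}"
    by (rule card_Un_disjoint) (use assms in auto)
  ultimately show ?thesis by (simp add: wedge_sign_def power_add)
qed

lemma wedge_sign_Un_right:
  fixes I J K :: "'n::{finite,linorder} set"
  assumes "J \<inter> K = {}"
  shows "wedge_sign I (J \<union> K) = wedge_sign I J * (wedge_sign I K :: 'r::comm_ring_1)"
proof -
  have "{(i, j). i \<in> I \<and> j \<in> J \<union> K \<and> j < i} =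
     {(i, j). i \<in> I \<and> j \<in> J \<and> j < i} \<union> {(i, j). i \<in> I \<and> j \<in> K \<and> j < i}" by auto
  moreover have "card \<dots> =
     card {(i, j). i \<in> I \<and> j \<in> J \<and> j < i} + card {(i, j). i \<in> I \<and> j \<in> K \<and> j < i}"
    by (rule card_Un_disjoint) (use assms in auto)
  ultimately show ?thesis by (simp add: wedge_sign_def power_add)
qed

lemma wedge_assoc: "wedge (wedge \<eta> \<theta>) \<zeta> = wedge \<eta> (wedge \<theta> \<zeta>)"
proof -
  have basis: "wedge (wedge (Poly_Mapping.single I f) (Poly_Mapping.single J g)) (Poly_Mapping.single K h)
    = wedge (Poly_Mapping.single I f) (wedge (Poly_Mapping.single J g) (Poly_Mapping.single K h))"
    for I J K :: "'a set" and f g h :: "('a, 'b) mpoly"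
  proof (cases "I \<inter> J = {} \<and> I \<inter> K = {} \<and> J \<inter> K = {}")
    case True
    then have "I \<inter> J = {}" "J \<inter> K = {}" "(I \<union> J) \<inter> K = {}" "I \<inter> (J \<union> K) = {}" by auto
    then show ?thesis
      by (simp add: wedge_single wedge_sign_Un_left wedge_sign_Un_right Un_assoc mult_ac)
  next
    case False
    then show ?thesis by (auto simp: wedge_single)
  qed
  show ?thesis
    by (subst (1 2) diff_form_expansion[of \<eta>], subst (1 2) diff_form_expansion[of \<theta>],
        subst (1 2) diff_form_expansion[of \<zeta>])
       (simp add: wedge_sum_left wedge_sum_right basis)
qed

lemma wedge_dx_same: "wedge (dx i) (dx i) = 0"
  by (simp add: dx_def wedge_single)

lemma wedge_dx_anticommute: "wedge (dx i) (dx j) = - wedge (dx j) (dx i)"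
proof -
  have "{(i', j'). i' \<in> {i} \<and> j' \<in> {j} \<and> j' < i'} = (if j < i then {(i, j)} else {})"
    for i j :: 'a by auto
  then have sign: "wedge_sign {i} {j} = (if j < i then - 1 else 1 :: ('a, 'b) mpoly)" for i j :: 'a
    by (simp only: wedge_sign_def) simp
  show ?thesis
    by (cases i j rule: linorder_cases)
       (auto simp: dx_def wedge_single sign insert_commute single_uminus)
qed

lemma wedge_list_dx:
  "sorted_wrt (<) js \<Longrightarrow> wedge_list (map dx js) = Poly_Mapping.single (set js) 1"
proof (induction js)
  case Nil
  then show ?case by (simp add: wedge_list_def)
next
  case (Cons i js)
  have "{(i', j). i' \<in> {i} \<and> j \<in> set js \<and> j < i'} = {}" using Cons.prems by auto
  then have "wedge_sign {i} (set js) = (1 :: ('a, 'b) mpoly)"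
    by (simp only: wedge_sign_def) simp
  moreover have "{i} \<inter> set js = {}" using Cons.prems by auto
  ultimately show ?case
    using Cons by (simp add: wedge_list_def wedge_single dx_def)
qed

lemma wedge_forms:
  assumes "\<eta> \<in> forms s" "\<theta> \<in> forms t"
  shows "wedge \<eta> \<theta> \<in> forms (s + t)"
proof -
  have "card L = s + t" if "Poly_Mapping.lookup (wedge \<eta> \<theta>) L \<noteq> 0" for L
  proof -
    from that obtain I J where
      *: "Poly_Mapping.lookup (if I \<inter> J = {} then Poly_Mapping.single (I \<union> J)
        (wedge_sign I J * Poly_Mapping.lookup \<eta> I * Poly_Mapping.lookup \<theta> J) else 0) L \<noteq> 0"
      unfolding wedge_def lookup_sum by (meson sum.not_neutral_contains_not_neutral)
    then have d: "I \<inter> J = {}" and L: "L = I \<union> J"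
      by (auto simp: lookup_single when_def split: if_splits)
    have "Poly_Mapping.lookup \<eta> I \<noteq> 0" "Poly_Mapping.lookup \<theta> J \<noteq> 0"
      using * by (auto simp: lookup_single when_def split: if_splits)
    then have "card I = s" "card J = t" using assms by (auto simp: forms_def in_keys_iff)
    with d L show ?thesis by (simp add: card_Un_disjoint)
  qed
  then show ?thesis by (simp add: forms_def in_keys_iff)
qed

end

theory Submission
  imports Defs
begin

text \<open>
  Let \<open>\<omega> = \<eta>\<^sub>1 \<and> \<dots> \<and> \<eta>\<^sub>l\<close>.  For an index \<open>a\<close> and a set \<open>J\<close> of indices, contraction of \<open>\<omega>\<close>
  with the vector field \<open>\<partial>/\<partial>x\<^sub>a\<close>, which is an antiderivation, shows that
  \<open>T(a, J) = (\<Sum>i. \<plusminus> (\<eta>\<^sub>i)\<^sub>a (\<eta>t\<^sub>i)\<^sub>J)\<close> is \<open>0\<close> if \<open>a \<in> J\<close>, and is up to sign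
  the coefficient of \<open>\<omega>\<close> at \<open>J \<union> {a}\<close> if \<open>a \<notin> J\<close> (\<open>contraction_wedge_list\<close>).  In particular, up
  to sign \<open>T(a, J)\<close> depends only on the multiset union of \<open>{a}\<close> and \<open>J\<close>.

  Suppose now that the maximum \<open>D\<close> of \<open>deg \<eta>\<^sub>i + deg \<eta>t\<^sub>i\<close> is attained by \<open>i = m\<close> only; then
  \<open>D \<noteq> -\<infinity>\<close>, as \<open>l \<ge> 2\<close>.  Say that an index set is extremal for a form if the form attains its
  degree there.  As the degree is additive on products (\<open>wdeg_mult\<close>), the degree of \<open>T(a, J)\<close>,
  shifted by the sum of the weights of \<open>a\<close> and of the elements of \<open>J\<close>, is equal to \<open>D\<close> if
  \<open>{a}\<close> is extremal for \<open>\<eta>\<^sub>m\<close> and \<open>J\<close> is extremal for \<open>\<eta>t\<^sub>m\<close>, and smaller than \<open>D\<close> otherwise.  Fix an extremal \<open>a\<close> for \<open>\<eta>\<^sub>m\<close>.  No \<open>J\<close> that contains \<open>a\<close> is extremal for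
  \<open>\<eta>t\<^sub>m\<close>, because \<open>T(a, J) = 0\<close>.  So an extremal \<open>J\<close> omits \<open>a\<close>.  Exchange \<open>a\<close> with an element
  \<open>b\<close> of \<open>J\<close>, which exists because \<open>l \<ge> 2\<close>: the set \<open>J' = (J - {b}) \<union> {a}\<close> contains \<open>a\<close>, hence
  is not extremal, and so \<open>T(b, J')\<close> has shifted degree below \<open>D\<close>.  But it agrees with \<open>T(a, J)\<close>
  up to sign, whose shifted degree is \<open>D\<close>.  This contradiction is
  \<open>maximal_degree_attained_again\<close>.
\<close>

section \<open>The weighted degree of polynomials\<close>

lemma wdeg_zero [simp]: "wdeg w 0 = Minf"
  by (simp add: wdeg_def)

lemma wdeg_nonzero: "f \<noteq> 0 \<Longrightarrow> wdeg w f = Fin (Max (mweight w ` Poly_Mapping.keys f))"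
  by (simp add: wdeg_def wcomp_nonzero)

lemma wdeg_neq_Pinf [simp]: "wdeg w f \<noteq> Pinf"
  by (simp add: wdeg_def)

lemma wdeg_eq_Minf_iff [simp]: "wdeg w f = Minf \<longleftrightarrow> f = 0"
  by (simp add: wdeg_def)

lemma wdeg_le_Fin_iff: "wdeg w f \<le> Fin d \<longleftrightarrow> (\<forall>a\<in>Poly_Mapping.keys f. mweight w a \<le> d)"
  by (cases "f = 0") (auto simp: wdeg_nonzero)

lemma wdeg_less_Fin_iff: "wdeg w f < Fin d \<longleftrightarrow> (\<forall>a\<in>Poly_Mapping.keys f. mweight w a < d)"
  by (cases "f = 0") (auto simp: wdeg_nonzero)

lemma wdeg_uminus [simp]: "wdeg w (- f) = wdeg w f"
proof -
  have "Poly_Mapping.keys (- f) = Poly_Mapping.keys f"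
    by (auto simp: in_keys_iff lookup_uminus)
  then show ?thesis by (simp add: wdeg_def wcomp_nonzero)
qed

lemma wdeg_power_minus_one_mult [simp]: "wdeg w ((- 1) ^ n * f) = wdeg w f"
  by (simp add: minus_one_power_iff)

lemma mweight_add: "mweight w (a + b) = mweight w a + mweight w b"
proof -
  have "(\<Sum>_<m + n. w i) = (\<Sum>_<m. w i) + (\<Sum>_<n. w i)" for m n :: nat and i
    by (induction n) (simp_all add: add_ac)
  then show ?thesis
    by (simp add: mweight_def lookup_add sum.distrib)
qed

lemma mweight_keys_wcomp: "a \<in> Poly_Mapping.keys (wcomp w \<gamma> f) \<Longrightarrow> mweight w a = \<gamma>"
  using wcomp_in_graded_piece[of w \<gamma> f] by (auto simp: graded_piece_def)

lemma wdeg_eq_FinD: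
  assumes "wdeg w f = Fin d"
  shows "wcomp w d f \<noteq> 0" "wdeg w (f - wcomp w d f) < Fin d"
proof -
  have "f \<noteq> 0" using assms by auto
  then have "d = Max (mweight w ` Poly_Mapping.keys f)"
    using assms by (simp add: wdeg_nonzero)
  then have "d \<in> mweight w ` Poly_Mapping.keys f"
    using \<open>f \<noteq> 0\<close> by simp
  then show "wcomp w d f \<noteq> 0"
    by (simp add: wcomp_nonzero[symmetric])
  have le: "\<forall>a\<in>Poly_Mapping.keys f. mweight w a \<le> d"
    using assms by (simp add: wdeg_le_Fin_iff[symmetric])
  show "wdeg w (f - wcomp w d f) < Fin d"
    unfolding wdeg_less_Fin_iff
  proof
    fix a assume "a \<in> Poly_Mapping.keys (f - wcomp w d f)"
    then have "mweight w a \<noteq> d" "a \<in> Poly_Mapping.keys f"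
      by (auto simp: in_keys_iff lookup_minus lookup_wcomp split: if_splits)
    then show "mweight w a < d" using le by (auto simp: less_le)
  qed
qed

lemma wdeg_add_dominated:
  assumes "wdeg w f < wdeg w g"
  shows "wdeg w (f + g) = wdeg w g"
proof -
  obtain d where d: "wdeg w g = Fin d"
    using assms by (cases "wdeg w g") auto
  have f: "\<forall>a\<in>Poly_Mapping.keys f. mweight w a < d"
    using assms by (simp add: d wdeg_less_Fin_iff)
  have "wdeg w (f + g) \<le> Fin d"
    using f d Poly_Mapping.keys_add[of f g] wdeg_le_Fin_iff[of w g d]
    by (force simp: wdeg_le_Fin_iff)
  moreover have "\<not> wdeg w (f + g) < Fin d"
  proof -
    obtain a where a: "a \<in> Poly_Mapping.keys g" "\<not> mweight w a < d"
      using d wdeg_less_Fin_iff[of w g d] by auto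
    then have "a \<in> Poly_Mapping.keys (f + g)"
      using f by (auto simp: in_keys_iff lookup_add)
    then show ?thesis using a by (auto simp: wdeg_less_Fin_iff)
  qed
  ultimately show ?thesis by (simp add: d)
qed

lemma wdeg_sum_less:
  assumes "\<And>i. i \<in> A \<Longrightarrow> wdeg w (f i) < Fin d"
  shows "wdeg w (\<Sum>i\<in>A. f i) < Fin d"
  using assms
proof (induction A rule: infinite_finite_induct)
  case (insert i A)
  then have "wdeg w (f i) < Fin d" "wdeg w (\<Sum>i\<in>A. f i) < Fin d" by auto
  then show ?case
    using insert.hyps Poly_Mapping.keys_add[of "f i" "\<Sum>i\<in>A. f i"]
    by (auto simp: wdeg_less_Fin_iff)
qed auto

lemma wdeg_mult_less:
  assumes "wdeg w f \<le> Fin c" "wdeg w g \<le> Fin d" "wdeg w f < Fin c \<or> wdeg w g < Fin d"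
  shows "wdeg w (f * g) < Fin (c + d)"
  unfolding wdeg_less_Fin_iff
proof
  fix e assume "e \<in> Poly_Mapping.keys (f * g)"
  then obtain a b where "e = a + b" "a \<in> Poly_Mapping.keys f" "b \<in> Poly_Mapping.keys g"
    using Poly_Mapping.keys_mult[of f g] by blast
  then show "mweight w e < c + d"
    using assms
    by (auto simp: wdeg_less_Fin_iff wdeg_le_Fin_iff mweight_add
        intro: add_less_le_mono add_le_less_mono)
qed

text \<open>
  The leading components of two nonzero polynomials have a nonzero product, since the polynomial
  ring is a domain; every other product of components has smaller degree.
\<close>

lemma wdeg_mult:
  fixes f g :: "('n::{finite,linorder}, 'k::field_char_0) mpoly"
  shows "wdeg w (f * g) = wdeg w f + wdeg w g"
proof (cases "f = 0 \<or> g = 0")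
  case True
  then show ?thesis
    by (cases "wdeg w f"; cases "wdeg w g") auto
next
  case False
  then obtain c d where c: "wdeg w f = Fin c" and d: "wdeg w g = Fin d"
    by (cases "wdeg w f"; cases "wdeg w g") auto
  define F where "F = wcomp w c f"
  define G where "G = wcomp w d g"
  have ne: "F \<noteq> 0" "G \<noteq> 0"
    and less: "wdeg w (f - F) < Fin c" "wdeg w (g - G) < Fin d"
    using wdeg_eq_FinD[OF c] wdeg_eq_FinD[OF d] by (simp_all add: F_def G_def)
  have "wdeg w F \<le> Fin c"
    by (auto simp: F_def wdeg_le_Fin_iff dest: mweight_keys_wcomp)
  then have "wdeg w ((f - F) * g) < Fin (c + d)" "wdeg w (F * (g - G)) < Fin (c + d)"
    using less d by (auto intro!: wdeg_mult_less)
  then have rest: "wdeg w ((f - F) * g + F * (g - G)) < Fin (c + d)"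
    using Poly_Mapping.keys_add[of "(f - F) * g" "F * (g - G)"]
    by (auto simp: wdeg_less_Fin_iff)
  have top: "wdeg w (F * G) = Fin (c + d)"
  proof -
    have "mweight w e = c + d" if "e \<in> Poly_Mapping.keys (F * G)" for e
      using that Poly_Mapping.keys_mult[of F G]
      by (auto simp: F_def G_def mweight_add dest!: mweight_keys_wcomp)
    moreover have "F * G \<noteq> 0" using ne by simp
    then have "Poly_Mapping.keys (F * G) \<noteq> {}" by simp
    ultimately have "mweight w ` Poly_Mapping.keys (F * G) = {c + d}"
      using image_constant_conv[of "c + d" "Poly_Mapping.keys (F * G)"]
        image_cong[of "Poly_Mapping.keys (F * G)" _ "mweight w" "\<lambda>_. c + d"] by auto
    then show ?thesis
      using \<open>F * G \<noteq> 0\<close> by (simp add: wdeg_nonzero)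
  qed
  have "f * g = ((f - F) * g + F * (g - G)) + F * G"
    by (simp add: algebra_simps)
  then have "wdeg w (f * g) = wdeg w (F * G)"
    using wdeg_add_dominated rest top by metis
  then show ?thesis by (simp add: top c d)
qed

section \<open>The weighted degree of forms\<close>

lemma add_Fin_less_iff:
  "u + Fin s < v + Fin s \<longleftrightarrow> u < v" for s :: "'g::linordered_ab_group_add"
  by (cases u; cases v) auto

lemma coeff_deg_le_form_deg:
  "wdeg w (Poly_Mapping.lookup \<eta> I) + Fin (\<Sum>i\<in>I. w i) \<le> form_deg w \<eta>"
  unfolding form_deg_def by (rule Max_ge) auto

lemma form_deg_attained:
  obtains I where "wdeg w (Poly_Mapping.lookup \<eta> I) + Fin (\<Sum>i\<in>I. w i) = form_deg w \<eta>"
proof -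
  have "form_deg w \<eta> \<in> (\<lambda>I. wdeg w (Poly_Mapping.lookup \<eta> I) + Fin (\<Sum>i\<in>I. w i)) ` UNIV"
    unfolding form_deg_def by (rule Max_in) auto
  then show ?thesis using that by auto
qed

lemma form_deg_neq_Pinf: "form_deg w \<eta> \<noteq> Pinf"
proof -
  obtain I where "wdeg w (Poly_Mapping.lookup \<eta> I) + Fin (\<Sum>i\<in>I. w i) = form_deg w \<eta>"
    by (rule form_deg_attained)
  then show ?thesis
    by (cases "wdeg w (Poly_Mapping.lookup \<eta> I)") auto
qed

section \<open>Contraction of exterior products\<close>

lemma wedge_list_Nil [simp]: "wedge_list [] = Poly_Mapping.single {} 1"
  by (simp add: wedge_list_def)

lemma wedge_list_Cons [simp]: "wedge_list (\<eta> # \<eta>s) = wedge \<eta> (wedge_list \<eta>s)"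
  by (simp add: wedge_list_def)

lemma wedge_list_forms:
  "(\<And>\<eta>. \<eta> \<in> set \<eta>s \<Longrightarrow> \<eta> \<in> forms 1) \<Longrightarrow> wedge_list \<eta>s \<in> forms (length \<eta>s)"
proof (induction \<eta>s)
  case Nil
  then show ?case by (simp add: forms_def)
next
  case (Cons \<eta> \<eta>s)
  then show ?case using wedge_forms[of \<eta> 1 "wedge_list \<eta>s" "length \<eta>s"] by simp
qed

lemma lookup_wedge_1_form:
  assumes "\<eta> \<in> forms 1"
  shows "Poly_Mapping.lookup (wedge \<eta> \<theta>) L =
    (\<Sum>c\<in>L. wedge_sign {c} (L - {c}) * Poly_Mapping.lookup \<eta> {c} *
       Poly_Mapping.lookup \<theta> (L - {c}))"
proof -
  define t where "t I J = Poly_Mapping.lookup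
      (if I \<inter> J = {} then Poly_Mapping.single (I \<union> J)
        (wedge_sign I J * Poly_Mapping.lookup \<eta> I * Poly_Mapping.lookup \<theta> J) else 0) L" for I J
  have "Poly_Mapping.lookup \<eta> I = 0" if "I \<notin> range (\<lambda>c. {c})" for I
  proof (rule ccontr)
    assume "\<not> ?thesis"
    then have "card I = 1" using assms by (simp add: forms_def in_keys_iff)
    then show False using that by (auto simp: card_1_singleton_iff)
  qed
  then have "t I J = 0" if "I \<notin> range (\<lambda>c. {c})" for I J
    using that by (simp add: t_def)
  then have "(\<Sum>I\<in>UNIV. \<Sum>J\<in>UNIV. t I J) = (\<Sum>I\<in>range (\<lambda>c. {c}). \<Sum>J\<in>UNIV. t I J)"
    by (intro sum.mono_neutral_right) auto
  also have "\<dots> = (\<Sum>c\<in>UNIV. \<Sum>J\<in>UNIV. t {c} J)"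
    by (subst sum.reindex) auto
  also have "\<dots> = (\<Sum>c\<in>UNIV. if c \<in> L then t {c} (L - {c}) else 0)"
  proof (rule sum.cong[OF refl])
    fix c
    have other: "t {c} J = 0" if "\<not> (c \<in> L \<and> J = L - {c})" for J
      using that by (auto simp: t_def lookup_single when_def)
    show "(\<Sum>J\<in>UNIV. t {c} J) = (if c \<in> L then t {c} (L - {c}) else 0)"
    proof (cases "c \<in> L")
      case True
      have "(\<Sum>J\<in>UNIV. t {c} J) = (\<Sum>J\<in>{L - {c}}. t {c} J)"
        by (rule sum.mono_neutral_right) (auto intro: other)
      then show ?thesis using True by simp
    qed (simp add: other)
  qed
  also have "\<dots> = (\<Sum>c\<in>L. t {c} (L - {c}))"
    by (simp add: sum.If_cases)
  also have "\<dots> = (\<Sum>c\<in>L. wedge_sign {c} (L - {c}) * Poly_Mapping.lookup \<eta> {c} *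
       Poly_Mapping.lookup \<theta> (L - {c}))"
    by (intro sum.cong refl) (auto simp: t_def lookup_single when_def insert_absorb)
  finally show ?thesis
    by (simp add: wedge_def lookup_sum t_def)
qed

text \<open>The coefficient at \<open>J\<close> of the interior product of \<open>\<theta>\<close> with \<open>\<partial>/\<partial>x\<^sub>a\<close>.\<close>

definition contraction ::
  "'n \<Rightarrow> ('n::{finite,linorder}, 'k::field_char_0) diff_form \<Rightarrow> 'n set \<Rightarrow> ('n, 'k) mpoly" where
  "contraction a \<theta> J =
     (if a \<in> J then 0 else wedge_sign {a} J * Poly_Mapping.lookup \<theta> (insert a J))"

lemma wedge_sign_square: "wedge_sign I J * wedge_sign I J = (1 :: 'r::comm_ring_1)"
  by (simp add: wedge_sign_def flip: power_add)

lemma wedge_sign_swap: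
  assumes "a \<noteq> c"
  shows "wedge_sign {a} {c} = - (wedge_sign {c} {a} :: 'r::comm_ring_1)"
proof -
  have "{(i, j). i \<in> {x} \<and> j \<in> {y} \<and> j < i} = (if y < x then {(x, y)} else {})" for x y :: 'a
    by auto
  then have "wedge_sign {x} {y} = (if y < x then - 1 else 1 :: 'r)" for x y :: 'a
    by (simp only: wedge_sign_def) simp
  then show ?thesis using assms by (auto simp: not_less_iff_gr_or_eq)
qed

text \<open>
  This is the antiderivation rule \<open>\<iota>\<^sub>a (\<eta> \<and> \<theta>) = \<eta>\<^sub>a \<theta> - \<eta> \<and> \<iota>\<^sub>a \<theta>\<close>, read off at \<open>J\<close>.
\<close>

lemma contraction_wedge_1_form:
  fixes \<eta> \<theta> :: "('n::{finite,linorder}, 'k::field_char_0) diff_form"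
  assumes \<eta>: "\<eta> \<in> forms 1"
  shows "contraction a (wedge \<eta> \<theta>) J =
    Poly_Mapping.lookup \<eta> {a} * Poly_Mapping.lookup \<theta> J -
    (\<Sum>c\<in>J. wedge_sign {c} (J - {c}) * Poly_Mapping.lookup \<eta> {c} * contraction a \<theta> (J - {c}))"
proof (cases "a \<in> J")
  case True
  \<comment> \<open>Both sides vanish: in the sum only \<open>c = a\<close> survives, with the square of a sign.\<close>
  have "(\<Sum>c\<in>J. wedge_sign {c} (J - {c}) * Poly_Mapping.lookup \<eta> {c} * contraction a \<theta> (J - {c}))
    = (\<Sum>c\<in>{a}. wedge_sign {c} (J - {c}) * Poly_Mapping.lookup \<eta> {c} * contraction a \<theta> (J - {c}))"
    using True by (intro sum.mono_neutral_right) (auto simp: contraction_def)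
  also have "\<dots> = (wedge_sign {a} (J - {a}) * wedge_sign {a} (J - {a})) *
      (Poly_Mapping.lookup \<eta> {a} * Poly_Mapping.lookup \<theta> J)"
    using True by (simp add: contraction_def insert_absorb mult_ac)
  finally show ?thesis
    using True by (simp add: contraction_def wedge_sign_square)
next
  case False
  define s where "s = (wedge_sign :: 'n set \<Rightarrow> 'n set \<Rightarrow> ('n, 'k) mpoly)"
  have sq: "s I K * s I K = 1" for I K by (simp add: s_def wedge_sign_square)
  have summand: "s {a} J * (s {c} (insert a J - {c}) * Poly_Mapping.lookup \<eta> {c} *
        Poly_Mapping.lookup \<theta> (insert a J - {c})) =
      - (s {c} (J - {c}) * Poly_Mapping.lookup \<eta> {c} * contraction a \<theta> (J - {c}))"
    if "c \<in> J" for c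
  proof -
    have ne: "a \<noteq> c" using that False by auto
    have set_eq: "insert a J - {c} = insert a (J - {c})" using ne by auto
    have J: "J = {c} \<union> (J - {c})" using that by auto
    have "s {a} J = s {a} {c} * s {a} (J - {c})"
      unfolding s_def by (subst J, rule wedge_sign_Un_right) auto
    moreover have "s {c} (insert a (J - {c})) = s {c} {a} * s {c} (J - {c})"
      unfolding s_def using wedge_sign_Un_right[of "{a}" "J - {c}" "{c}"] False by simp
    moreover have "s {a} {c} = - s {c} {a}"
      unfolding s_def by (rule wedge_sign_swap[OF ne])
    ultimately have "s {a} J * s {c} (insert a (J - {c})) =
        - ((s {c} {a} * s {c} {a}) * (s {c} (J - {c}) * s {a} (J - {c})))"
      by (simp add: mult_ac)
    then have "s {a} J * s {c} (insert a (J - {c})) = - (s {c} (J - {c}) * s {a} (J - {c}))"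
      by (simp add: sq)
    then have "(s {a} J * s {c} (insert a (J - {c}))) * (Poly_Mapping.lookup \<eta> {c} *
        Poly_Mapping.lookup \<theta> (insert a (J - {c}))) =
      - (s {c} (J - {c}) * s {a} (J - {c})) * (Poly_Mapping.lookup \<eta> {c} *
        Poly_Mapping.lookup \<theta> (insert a (J - {c})))"
      by simp
    then show ?thesis
      using False by (simp add: set_eq contraction_def s_def[symmetric] mult_ac)
  qed
  have "contraction a (wedge \<eta> \<theta>) J = s {a} J * (\<Sum>c\<in>insert a J. s {c} (insert a J - {c}) *
      Poly_Mapping.lookup \<eta> {c} * Poly_Mapping.lookup \<theta> (insert a J - {c}))"
    using False by (simp add: contraction_def lookup_wedge_1_form[OF \<eta>] s_def)
  also have "\<dots> = s {a} J * (s {a} J * Poly_Mapping.lookup \<eta> {a} * Poly_Mapping.lookup \<theta> J) +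
      (\<Sum>c\<in>J. s {a} J * (s {c} (insert a J - {c}) *
        Poly_Mapping.lookup \<eta> {c} * Poly_Mapping.lookup \<theta> (insert a J - {c})))"
    using False by (simp add: distrib_left sum_distrib_left)
  also have "s {a} J * (s {a} J * Poly_Mapping.lookup \<eta> {a} * Poly_Mapping.lookup \<theta> J) =
      Poly_Mapping.lookup \<eta> {a} * Poly_Mapping.lookup \<theta> J"
    using sq[of "{a}" J] by (simp flip: mult.assoc)
  finally show ?thesis
    by (simp add: summand sum_negf cong: sum.cong) (simp add: s_def)
qed

text \<open>
  Iterating the antiderivation rule moves \<open>\<iota>\<^sub>a\<close> past the first \<open>i\<close> factors at the cost of
  \<open>(- 1)\<^sup>i\<close>; it then removes the factor with index \<open>i\<close> (counted from \<open>0\<close>).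
\<close>

lemma contraction_wedge_list:
  fixes \<eta>s :: "('n::{finite,linorder}, 'k::field_char_0) diff_form list"
  assumes "\<And>\<eta>. \<eta> \<in> set \<eta>s \<Longrightarrow> \<eta> \<in> forms 1"
  shows "contraction a (wedge_list \<eta>s) J =
    (\<Sum>i<length \<eta>s. (- 1) ^ i * (Poly_Mapping.lookup (\<eta>s ! i) {a} *
       Poly_Mapping.lookup (wedge_list (take i \<eta>s @ drop (Suc i) \<eta>s)) J))"
  using assms
proof (induction \<eta>s arbitrary: J)
  case Nil
  then show ?case by (simp add: contraction_def lookup_single)
next
  case (Cons \<eta> \<eta>s)
  have \<eta>: "\<eta> \<in> forms 1" using Cons.prems by simp
  let ?W = "\<lambda>i. wedge_list (take i \<eta>s @ drop (Suc i) \<eta>s)"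
  let ?k = "\<lambda>c. wedge_sign {c} (J - {c}) * Poly_Mapping.lookup \<eta> {c}"
  have "(\<Sum>c\<in>J. ?k c * contraction a (wedge_list \<eta>s) (J - {c})) =
      (\<Sum>c\<in>J. \<Sum>i<length \<eta>s. ?k c * ((- 1) ^ i * (Poly_Mapping.lookup (\<eta>s ! i) {a} *
        Poly_Mapping.lookup (?W i) (J - {c}))))"
    using Cons.IH Cons.prems by (simp add: sum_distrib_left)
  also have "\<dots> = (\<Sum>i<length \<eta>s. (- 1) ^ i * (Poly_Mapping.lookup (\<eta>s ! i) {a} *
        (\<Sum>c\<in>J. ?k c * Poly_Mapping.lookup (?W i) (J - {c}))))"
    by (subst sum.swap) (simp add: sum_distrib_left mult_ac)
  also have "\<dots> = (\<Sum>i<length \<eta>s. (- 1) ^ i * (Poly_Mapping.lookup (\<eta>s ! i) {a} *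
        Poly_Mapping.lookup (wedge \<eta> (?W i)) J))"
    by (simp add: lookup_wedge_1_form[OF \<eta>])
  finally show ?case
    by (simp add: contraction_wedge_1_form[OF \<eta>] sum.lessThan_Suc_shift sum_negf
        del: sum.lessThan_Suc)
qed

section \<open>The maximum of the degrees\<close>

text \<open>
  If only the index \<open>m\<close> attained the maximum, its summand would be the leading part of
  \<open>contraction a \<omega>\<close> at every extremal pair of coefficients, which the exchange symmetry of
  \<open>contraction a \<omega>\<close> in \<open>a\<close> and the elements of \<open>J\<close> forbids.
\<close>

lemma maximal_degree_attained_again:
  fixes \<eta>s :: "('n::{finite,linorder}, 'k::field_char_0) diff_form list"
    and w :: "'n \<Rightarrow> 'g::linordered_ab_group_add"
  defines "W \<equiv> \<lambda>i. wedge_list (take i \<eta>s @ drop (Suc i) \<eta>s)"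
  defines "e \<equiv> \<lambda>i. form_deg w (\<eta>s ! i) + form_deg w (W i)"
  assumes forms: "\<And>\<eta>. \<eta> \<in> set \<eta>s \<Longrightarrow> \<eta> \<in> forms 1"
    and len: "2 \<le> length \<eta>s" and m: "m < length \<eta>s"
  shows "\<exists>i<length \<eta>s. i \<noteq> m \<and> e m \<le> e i"
proof (rule ccontr)
  assume "\<not> ?thesis"
  then have unique: "e i < e m" if "i < length \<eta>s" "i \<noteq> m" for i
    using that by (auto simp: not_le)
  obtain i where "i < length \<eta>s" "i \<noteq> m"
    using len that[of 0] that[of 1] by (cases "m = 0") (auto simp del: length_greater_0_conv)
  then have "e m \<noteq> Minf" using unique[of i] by auto
  then obtain p q where p: "form_deg w (\<eta>s ! m) = Fin p" and q: "form_deg w (W m) = Fin q"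
    using form_deg_neq_Pinf[of w "\<eta>s ! m"] form_deg_neq_Pinf[of w "W m"]
    by (cases "form_deg w (\<eta>s ! m)"; cases "form_deg w (W m)") (auto simp: e_def)
  define A where "A c \<longleftrightarrow> wdeg w (Poly_Mapping.lookup (\<eta>s ! m) {c}) + Fin (w c) = Fin p" for c
  define B where "B K \<longleftrightarrow> wdeg w (Poly_Mapping.lookup (W m) K) + Fin (\<Sum>i\<in>K. w i) = Fin q" for K
  define t where "t i c K = (- 1) ^ i * (Poly_Mapping.lookup (\<eta>s ! i) {c} *
      Poly_Mapping.lookup (W i) K)" for i c K
  define T where "T c K = (\<Sum>i<length \<eta>s. t i c K)" for c K
  define s where "s c K = w c + (\<Sum>i\<in>K. w i)" for c K
  have T: "T c K = contraction c (wedge_list \<eta>s) K" for c K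
    unfolding T_def t_def W_def by (rule contraction_wedge_list[OF forms, symmetric])

  \<comment> \<open>The shift \<open>s c K\<close> refers degrees of products of coefficients to those of the forms.\<close>
  have deg_t: "wdeg w (t i c K) + Fin (s c K) =
      (wdeg w (Poly_Mapping.lookup (\<eta>s ! i) {c}) + Fin (w c)) +
      (wdeg w (Poly_Mapping.lookup (W i) K) + Fin (\<Sum>i\<in>K. w i))" for i c K
    unfolding t_def s_def wdeg_power_minus_one_mult unfolding wdeg_mult
    by (simp only: plus_extended.simps(1)[symmetric] add_ac)
  have coeff_le: "wdeg w (Poly_Mapping.lookup (\<eta>s ! i) {c}) + Fin (w c) \<le> form_deg w (\<eta>s ! i)"
    "wdeg w (Poly_Mapping.lookup (W i) K) + Fin (\<Sum>i\<in>K. w i) \<le> form_deg w (W i)" for i c K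
    using coeff_deg_le_form_deg[of w "\<eta>s ! i" "{c}"] coeff_deg_le_form_deg[of w "W i" K]
    by simp_all
  have em: "e m = Fin (p + q)" by (simp add: e_def p q)
  have others: "wdeg w (t i c K) + Fin (s c K) < Fin (p + q)"
    if "i < length \<eta>s" "i \<noteq> m" for i c K
  proof -
    have "wdeg w (t i c K) + Fin (s c K) \<le> e i"
      unfolding deg_t e_def by (intro add_mono coeff_le)
    then show ?thesis using unique[OF that] em by simp
  qed
  have shift: "u + Fin (s c K) < Fin (p + q) \<longleftrightarrow> u < Fin (p + q - s c K)" for u c K
    using add_Fin_less_iff[of u "s c K" "Fin (p + q - s c K)"] by simp

  have extremal: "wdeg w (T c K) = Fin (p + q - s c K)" if "A c" "B K" for c K
  proof -
    have "wdeg w (t m c K) + Fin (s c K) = Fin (p + q)"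
      using that by (simp add: deg_t A_def B_def)
    then have tm: "wdeg w (t m c K) = Fin (p + q - s c K)"
      by (cases "wdeg w (t m c K)") (auto simp: algebra_simps)
    have "wdeg w (\<Sum>i\<in>{..<length \<eta>s} - {m}. t i c K) < Fin (p + q - s c K)"
      by (rule wdeg_sum_less) (use others shift in auto)
    then have "wdeg w ((\<Sum>i\<in>{..<length \<eta>s} - {m}. t i c K) + t m c K) = wdeg w (t m c K)"
      by (intro wdeg_add_dominated) (simp add: tm)
    then show ?thesis
      using m tm by (simp add: T_def sum.remove[of _ m] add.commute)
  qed
  have not_extremal: "wdeg w (T c K) < Fin (p + q - s c K)" if "\<not> B K" for c K
    unfolding T_def
  proof (rule wdeg_sum_less)
    fix i assume i: "i \<in> {..<length \<eta>s}"
    have "wdeg w (t i c K) + Fin (s c K) < Fin (p + q)"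
    proof (cases "i = m")
      case True
      have "wdeg w (Poly_Mapping.lookup (W m) K) + Fin (\<Sum>i\<in>K. w i) < Fin q"
        using coeff_le(2)[of m K] that by (simp add: B_def q)
      moreover have "wdeg w (Poly_Mapping.lookup (\<eta>s ! m) {c}) + Fin (w c) \<le> Fin p"
        using coeff_le(1)[of m c] by (simp add: p)
      moreover have "u + v < Fin (p + q)" if "v < Fin q" "u \<le> Fin p" for u v
        using that by (cases u; cases v) (auto intro: add_le_less_mono)
      ultimately show ?thesis unfolding True deg_t by blast
    next
      case False
      then show ?thesis using others i by simp
    qed
    then show "wdeg w (t i c K) < Fin (p + q - s c K)" by (simp add: shift)
  qed

  obtain a where a: "A a"
  proof -
    obtain I where I: "wdeg w (Poly_Mapping.lookup (\<eta>s ! m) I) + Fin (\<Sum>i\<in>I. w i) = Fin p"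
      using form_deg_attained[of w "\<eta>s ! m"] p by metis
    then have "Poly_Mapping.lookup (\<eta>s ! m) I \<noteq> 0" by auto
    then have "card I = 1"
      using forms[of "\<eta>s ! m"] m by (auto simp: forms_def in_keys_iff)
    then obtain a where "I = {a}" by (auto simp: card_1_singleton_iff)
    then show ?thesis using that I by (simp add: A_def)
  qed
  obtain J where J: "B J"
    using form_deg_attained[of w "W m"] q B_def by metis
  have omits: "a \<notin> K" if "B K" for K
    using extremal[OF a that] by (auto simp: T contraction_def)
  obtain b where b: "b \<in> J"
  proof -
    have "Poly_Mapping.lookup (W m) J \<noteq> 0" using J by (auto simp: B_def)
    moreover have "W m \<in> forms (length \<eta>s - 1)"
    proof -
      have "length (take m \<eta>s @ drop (Suc m) \<eta>s) = length \<eta>s - 1" using m by simp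
      then show ?thesis
        using wedge_list_forms[of "take m \<eta>s @ drop (Suc m) \<eta>s"] forms
        by (auto simp: W_def dest: in_set_takeD in_set_dropD)
    qed
    ultimately have "card J \<noteq> 0" using len by (auto simp: forms_def in_keys_iff)
    then show ?thesis using that by fastforce
  qed
  \<comment> \<open>Both \<open>T b J'\<close> and \<open>T a J\<close> are, up to sign, the coefficient of the whole product at
    \<open>insert a J\<close>, with the same shift, but only the second pair is extremal.\<close>
  define J' where "J' = insert a (J - {b})"
  have "a \<notin> J" by (rule omits[OF J])
  then have "b \<notin> J'" "insert b J' = insert a J"
    using b by (auto simp: J'_def)
  then have "wdeg w (T b J') = wdeg w (Poly_Mapping.lookup (wedge_list \<eta>s) (insert a J))"
    "wdeg w (T a J) = wdeg w (Poly_Mapping.lookup (wedge_list \<eta>s) (insert a J))"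
    using \<open>a \<notin> J\<close> by (simp_all add: T contraction_def wedge_sign_def)
  moreover have "s b J' = s a J"
    using \<open>a \<notin> J\<close> b by (simp add: s_def J'_def sum.remove[of J b] add_ac)
  moreover have "wdeg w (T b J') < Fin (p + q - s b J')"
    by (rule not_extremal) (use omits[of J'] in \<open>auto simp: J'_def\<close>)
  ultimately show False using extremal[OF a J] by simp
qed

theorem theorem5p2:
  fixes w :: "'n::{finite,linorder} \<Rightarrow> 'g::linordered_ab_group_add"
    and \<eta> :: "nat \<Rightarrow> ('n, 'k::field_char_0) diff_form"
    and \<eta>t :: "nat \<Rightarrow> ('n, 'k) diff_form"
    and l :: nat
  assumes "2 \<le> l"
    and "\<And>i. 1 \<le> i \<Longrightarrow> i \<le> l \<Longrightarrow> \<eta> i \<in> forms 1"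
    and "\<And>i. 1 \<le> i \<Longrightarrow> i \<le> l \<Longrightarrow> \<eta>t i = wedge_list (map \<eta> ([1..<i] @ [Suc i..<Suc l]))"
  shows "\<exists>i1 i2. 1 \<le> i1 \<and> i1 < i2 \<and> i2 \<le> l \<and>
    form_deg w (\<eta> i1) + form_deg w (\<eta>t i1) = form_deg w (\<eta> i2) + form_deg w (\<eta>t i2) \<and>
    (\<forall>i. 1 \<le> i \<and> i \<le> l \<longrightarrow>
      form_deg w (\<eta> i) + form_deg w (\<eta>t i) \<le> form_deg w (\<eta> i2) + form_deg w (\<eta>t i2))"
proof -
  define \<eta>s where "\<eta>s = map \<eta> [1..<Suc l]"
  define e where "e i = form_deg w (\<eta> i) + form_deg w (\<eta>t i)" for i
  have len: "length \<eta>s = l" by (simp add: \<eta>s_def)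
  have forms: "\<theta> \<in> forms 1" if "\<theta> \<in> set \<eta>s" for \<theta>
    using that assms(2) by (auto simp: \<eta>s_def)
  have e: "e i = form_deg w (\<eta>s ! (i - 1)) +
      form_deg w (wedge_list (take (i - 1) \<eta>s @ drop (Suc (i - 1)) \<eta>s))"
    if "1 \<le> i" "i \<le> l" for i
  proof -
    have "\<eta>s ! (i - 1) = \<eta> i"
      using that by (simp add: \<eta>s_def nth_upt del: upt_Suc)
    moreover have "take (i - 1) \<eta>s = map \<eta> [1..<i]" "drop (Suc (i - 1)) \<eta>s = map \<eta> [Suc i..<Suc l]"
      using that by (simp_all add: \<eta>s_def take_map drop_map take_upt drop_upt del: upt_Suc)
    ultimately show ?thesis
      using assms(3)[OF that] by (simp add: e_def del: upt_Suc)
  qed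
  have "Max (e ` {1..l}) \<in> e ` {1..l}"
    using assms(1) by (intro Max_in) auto
  then obtain m where m: "1 \<le> m" "m \<le> l" and "e m = Max (e ` {1..l})" by auto
  then have max: "e i \<le> e m" if "1 \<le> i" "i \<le> l" for i
    using that by simp
  have "2 \<le> length \<eta>s" "m - 1 < length \<eta>s" using assms(1) m by (auto simp: len)
  from maximal_degree_attained_again[OF forms this, of w]
  obtain i where i: "i < l" "i \<noteq> m - 1"
    and le: "form_deg w (\<eta>s ! (m - 1)) +
      form_deg w (wedge_list (take (m - 1) \<eta>s @ drop (Suc (m - 1)) \<eta>s)) \<le>
      form_deg w (\<eta>s ! i) + form_deg w (wedge_list (take i \<eta>s @ drop (Suc i) \<eta>s))"
    unfolding len by blast
  define j where "j = Suc i"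
  have j: "1 \<le> j" "j \<le> l" "j \<noteq> m" using i m by (auto simp: j_def)
  have "e m \<le> e j" using le e[OF m] e[OF j(1,2)] by (simp add: j_def)
  then have "e j = e m" using max[OF j(1,2)] by simp
  then have "1 \<le> min m j \<and> min m j < max m j \<and> max m j \<le> l \<and> e (min m j) = e (max m j) \<and>
      (\<forall>i. 1 \<le> i \<and> i \<le> l \<longrightarrow> e i \<le> e (max m j))"
    using m j max by (auto simp: min_def max_def)
  then show ?thesis unfolding e_def by blast
qed

end
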